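(* The alternative base-10 multiplication algorithm is correct: for all natural numbers $A$ and $B$ it outputs the product $A\cdot B$. Explicitly, let $A$ and $B$ be natural numbers, and write $B=\sum_{j=0}^{n-1} b_j\,10^j$ with $n\ge 1$ and digits $b_j\in\{0,1,\dots,9\}$. Define $S_0 = A\cdot b_0$, $r_0 = S_0 \bmod 10$, $c_1=\lfloor S_0/10\rfloor$, and, for each $1\le k\le n-1$, $S_k = A\cdot b_k + c_k$, $r_k = S_k \bmod 10$, $c_{k+1}=\lfloor S_k/10\rfloor$. Then the output $$R = c_n\,10^n+\sum_{i=0}^{n-1} r_i\,10^i$$ of the algorithm satisfies $R = A\cdot B$.
   Context: All numbers are natural numbers represented in base 10. For a natural number $x$, $x \bmod 10$ denotes the remainder of $x$ on division by 10 (the units digit of $x$), and $\lfloor x/10\rfloor$ denotes the integer quotient of $x$ by 10 (the number obtained by deleting the units digit of $x$). The "alternative algorithm" takes $A$ and the decimal digits $b_0,\dots,b_{n-1}$ of $B$ ($b_0$ being the units digit), successively computes the numbers $S_k$, the output digits $r_k$ and the carried values $c_{k+1}$ for $k=0,1,\dots,n-1$ by the rules given in the claim, and outputs $R$. *)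

theory Defs
  imports Main
begin

text \<open>
  Here \<open>A\<close> is the multiplicand and \<open>b j\<close> the digit of the multiplier at position \<open>j\<close>
  (\<open>b 0\<close> is the units digit). The value \<open>alt_carry A b 0\<close> is a dummy: carries are
  indexed from 1, and no step of the algorithm uses it.
\<close>

fun alt_step :: "nat \<Rightarrow> (nat \<Rightarrow> nat) \<Rightarrow> nat \<Rightarrow> nat"
  and alt_carry :: "nat \<Rightarrow> (nat \<Rightarrow> nat) \<Rightarrow> nat \<Rightarrow> nat"
where
  "alt_step A b 0 = A * b 0"
| "alt_step A b (Suc k) = A * b (Suc k) + alt_carry A b (Suc k)"
| "alt_carry A b 0 = 0"
| "alt_carry A b (Suc k) = alt_step A b k div 10"

definition alt_digit :: "nat \<Rightarrow> (nat \<Rightarrow> nat) \<Rightarrow> nat \<Rightarrow> nat" where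
  "alt_digit A b k = alt_step A b k mod 10"

definition alt_mult :: "nat \<Rightarrow> (nat \<Rightarrow> nat) \<Rightarrow> nat \<Rightarrow> nat" where
  "alt_mult A b n = alt_carry A b n * 10 ^ n + (\<Sum>i = 0..<n. alt_digit A b i * 10 ^ i)"

end

theory Submission
  imports Defs
begin

text \<open>Invariant: \<open>alt_mult A b n\<close>, carry included, is A times the number formed
  by the lowest n digits. Splitting a step into its new carry and output digit loses nothing, so the
  next digit replaces the old carry term by terms worth that carry plus A * b n, at weight 10 ^ n
  (\<open>alt_mult_Suc\<close>). Induction on n finishes.\<close>

text \<open>The dummy carry 0 at index 0 makes the first step an instance of the general
  rule.\<close>

lemma alt_step_eq: "alt_step A b k = A * b k + alt_carry A b k"
  by (cases k) simp_all

text \<open>Division with remainder of \<open>alt_step A b k\<close> by 10.\<close>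

lemma alt_carry_Suc_digit:
  "alt_carry A b (Suc k) * 10 + alt_digit A b k = A * b k + alt_carry A b k"
  by (simp add: alt_digit_def flip: alt_step_eq)

lemma alt_mult_Suc: "alt_mult A b (Suc n) = alt_mult A b n + A * b n * 10 ^ n"
proof -
  have "alt_mult A b (Suc n) =
      (alt_carry A b (Suc n) * 10 + alt_digit A b n) * 10 ^ n
      + (\<Sum>i = 0..<n. alt_digit A b i * 10 ^ i)"
    \<comment> \<open>The new carry must stay folded so that \<open>alt_carry_Suc_digit\<close> can
      rewrite the bracket.\<close>
    by (simp add: alt_mult_def algebra_simps del: alt_carry.simps)
  then show ?thesis
    by (simp only: alt_carry_Suc_digit) (simp add: alt_mult_def algebra_simps)
qed

lemma alt_mult_eq_sum: "alt_mult A b n = A * (\<Sum>j = 0..<n. b j * 10 ^ j)"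
proof (induction n)
  case 0
  show ?case by (simp add: alt_mult_def)
next
  case (Suc n)
  then show ?case by (simp add: alt_mult_Suc algebra_simps)
qed

theorem mainTheorem1:
  fixes A B n :: nat and b :: "nat \<Rightarrow> nat"
  assumes "n \<ge> 1"
    and "\<And>j. j < n \<Longrightarrow> b j \<in> {0..9}"
    and "B = (\<Sum>j = 0..<n. b j * 10 ^ j)"
  shows "alt_mult A b n = A * B"
  using assms(3) by (simp add: alt_mult_eq_sum)

end
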